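(* Let $\Omega=\{(x,y)\in\mathbb{R}^{N_x}\times\mathbb{R}^{N_y}: Ax+By\le c\}$ be a polytope (in particular bounded), and let $\Phi=\{x\in\mathbb{R}^{N_x}:\exists\, y\in\mathbb{R}^{N_y}\ \text{such that}\ (x,y)\in\Omega\}$ be its projection onto the $x$-space. Consider the progressive vertex enumeration (PVE) algorithm described in the context, applied to $\Omega$ with error tolerance $\varepsilon\ge 0$ and initial vertex set $V^{(0)}$, and let $\hat\Phi$ denote its output. (i) If $\varepsilon>0$, then the output is a conservative (inner) approximation of the exact projection, i.e. $\hat\Phi\subseteq\Phi$. (ii) If $\varepsilon=0$, then the algorithm terminates after finitely many steps and its output is the exact projection, i.e. $\hat\Phi=\Phi$.
   Context: Here $A,B$ are real matrices and $c$ is a real vector of compatible sizes. $\mathrm{conv}(V)$ denotes the convex hull of a finite set $V\subset\mathbb{R}^{N_x}$. The projection $\Phi$ is a polytope in $\mathbb{R}^{N_x}$. An approximation $\hat\Phi$ of $\Phi$ is called conservative if it is a subset of $\Phi$. Vertex identification problem. For a direction $\alpha\in\mathbb{R}^{N_x}$, solve the linear program $$\max_{x,y}\ \alpha^\top x\quad\text{s.t.}\quad Ax+By\le c .$$ The identified vertex is the $x$-part $\hat x$ of an optimal solution; it is taken to be a vertex (extreme point) of $\Phi$. PVE algorithm. Input: $A,B,c$; an error tolerance $\varepsilon\ge 0$; and a finite set $V^{(0)}$ of at least $N_x+1$ vertices of $\Phi$ whose convex hull is nondegenerate (full-dimensional in $\mathbb{R}^{N_x}$). These vertices can be searched by solving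 the vertex identification problem along the directions $\alpha=\pm e_i$, where $e_i$ is the $i$th standard basis vector. Initialization: set $k=0$ and $V=V^{(0)}$. Outer loop. Repeat the following. 1. Set $k\leftarrow k+1$. 2. Construct the convex hull of the existing vertices, $\hat\Phi^{(k)}=\mathrm{conv}(V)$, and write it by its facet-defining inequalities as $\hat\Phi^{(k)}=\{x:\tilde A^{(k)}_j x\le \tilde d^{(k)}_j,\ j=1,\dots,J^{(k)}\}$. Here there is one inequality per facet and the row vector $\tilde A^{(k)}_j\neq 0$ is an outer normal of the $j$th facet. 3. Set $H^{(k)}=\emptyset$. 4. Inner loop. For each $j=1,\dots,J^{(k)}$: - Solve the vertex identification problem with $\alpha^\top=\tilde A^{(k)}_j$, obtaining a vertex $\hat x^{(k,j)}$ of $\Phi$. - Compute its improvement ratio $\Delta h^{(k,j)}=\dfrac{\tilde A^{(k)}_j\hat x^{(k,j)}-\tilde d^{(k)}_j}{\|\tilde A^{(k)}_j\|}$ (Euclidean norm). - If $\Delta h^{(k,j)}>0$ and $\hat x^{(k,j)}\notin V$, add $\hat x^{(k,j)}$ to $V$ and add $\Delta h^{(k,j)}$ to $H^{(k)}$. The hull $\hat\Phi^{(k)}$ and its facets are not changed during the inner loop. 5. Set $D^{(k)}=\max H^{(k)}$, with the convention $\max\emptyset=0$. Stop when $D^{(k)}\le\varepsilon$. Output: $\hat\Phi=\mathrm{conv}(V)$. *)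

theory Defs
  imports "HOL-Analysis.Analysis"
begin

definition feasible_set ::
  "real^'nx^'m \<Rightarrow> real^'ny^'m \<Rightarrow> real^'m \<Rightarrow> ((real^'nx) \<times> (real^'ny)) set"
  where "feasible_set A B c = {(x, y). A *v x + B *v y \<le> c}"

definition projection ::
  "real^'nx^'m \<Rightarrow> real^'ny^'m \<Rightarrow> real^'m \<Rightarrow> (real^'nx) set"
  where "projection A B c = {x. \<exists>y. (x, y) \<in> feasible_set A B c}"

text \<open>
  The solver may return any optimal solution whose \<open>x\<close>-part is a vertex of the projection;
  hence a relation rather than a function.
\<close>
definition identified_vertex ::
  "real^'nx^'m \<Rightarrow> real^'ny^'m \<Rightarrow> real^'m \<Rightarrow> real^'nx \<Rightarrow> real^'nx \<Rightarrow> bool"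
  where "identified_vertex A B c \<alpha> x \<longleftrightarrow>
    (\<exists>y. is_arg_max (\<lambda>(x, y). \<alpha> \<bullet> x) (\<lambda>z. z \<in> feasible_set A B c) (x, y))
    \<and> x extreme_point_of (projection A B c)"

text \<open>
  A pair \<open>(a, d)\<close> stands for the inequality \<open>a \<bullet> x \<le> d\<close>. The last two conjuncts say that
  listing the faces on which the inequalities are tight enumerates the facets of \<open>P\<close>, each
  exactly once. Neither the order of the facets nor the scaling of the normals is prescribed.
\<close>
definition facet_description :: "'a::euclidean_space set \<Rightarrow> ('a \<times> real) list \<Rightarrow> bool"
  where "facet_description P L \<longleftrightarrow>
    P = {x. \<forall>(a, d) \<in> set L. a \<bullet> x \<le> d}
    \<and> (\<forall>(a, d) \<in> set L. a \<noteq> 0)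
    \<and> distinct (map (\<lambda>(a, d). P \<inter> {x. a \<bullet> x = d}) L)
    \<and> set (map (\<lambda>(a, d). P \<inter> {x. a \<bullet> x = d}) L) = {F. F facet_of P}"

definition improvement_ratio :: "'a::euclidean_space \<Rightarrow> real \<Rightarrow> 'a \<Rightarrow> real"
  where "improvement_ratio a d x = (a \<bullet> x - d) / norm a"

definition max_improvement :: "real set \<Rightarrow> real"
  where "max_improvement H = (if H = {} then 0 else Max H)"

text \<open>
  Control states: \<open>Outer V\<close> is the head of the outer loop; in \<open>Inner V H L\<close> the list \<open>L\<close> holds
  the inequalities of the current hull still to be processed by the inner loop; \<open>Done V\<close> is
  the stopped state. The iteration counter does not influence the execution and is left out.
\<close>
datatype 'a pve_state =
    Outer "'a set"
  | Inner "'a set" "real set" "('a \<times> real) list"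
  | Done "'a set"

inductive pve_step ::
  "real^'nx^'m \<Rightarrow> real^'ny^'m \<Rightarrow> real^'m \<Rightarrow> real \<Rightarrow>
   (real^'nx) pve_state \<Rightarrow> (real^'nx) pve_state \<Rightarrow> bool"
  for A :: "real^'nx^'m" and B :: "real^'ny^'m" and c :: "real^'m" and \<epsilon> :: real
  where
    build_hull:
      "facet_description (convex hull V) L
       \<Longrightarrow> pve_step A B c \<epsilon> (Outer V) (Inner V {} L)"
  | add_vertex:
      "identified_vertex A B c a x
       \<Longrightarrow> improvement_ratio a d x > 0 \<and> x \<notin> V
       \<Longrightarrow> pve_step A B c \<epsilon> (Inner V H ((a, d) # L))
             (Inner (insert x V) (insert (improvement_ratio a d x) H) L)"
  | skip_vertex:
      "identified_vertex A B c a x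
       \<Longrightarrow> \<not> (improvement_ratio a d x > 0 \<and> x \<notin> V)
       \<Longrightarrow> pve_step A B c \<epsilon> (Inner V H ((a, d) # L)) (Inner V H L)"
  | continue:
      "\<not> max_improvement H \<le> \<epsilon> \<Longrightarrow> pve_step A B c \<epsilon> (Inner V H []) (Outer V)"
  | stop:
      "max_improvement H \<le> \<epsilon> \<Longrightarrow> pve_step A B c \<epsilon> (Inner V H []) (Done V)"

text \<open>The possible outputs; there may be several because the execution is nondeterministic.\<close>
definition pve_output ::
  "real^'nx^'m \<Rightarrow> real^'ny^'m \<Rightarrow> real^'m \<Rightarrow> real \<Rightarrow> (real^'nx) set \<Rightarrow> (real^'nx) set \<Rightarrow> bool"
  where "pve_output A B c \<epsilon> V0 P \<longleftrightarrow>
    (\<exists>V. (pve_step A B c \<epsilon>)\<^sup>*\<^sup>* (Outer V0) (Done V) \<and> P = convex hull V)"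

text \<open>
  Termination for every resolution of the nondeterminism: no execution is infinite, and an
  execution that cannot be continued has stopped regularly. In particular, an output exists.
\<close>
definition pve_terminates ::
  "real^'nx^'m \<Rightarrow> real^'ny^'m \<Rightarrow> real^'m \<Rightarrow> real \<Rightarrow> (real^'nx) set \<Rightarrow> bool"
  where "pve_terminates A B c \<epsilon> V0 \<longleftrightarrow>
    (\<nexists>s. s 0 = Outer V0 \<and> (\<forall>i::nat. pve_step A B c \<epsilon> (s i) (s (Suc i))))
    \<and> (\<forall>t. (pve_step A B c \<epsilon>)\<^sup>*\<^sup>* (Outer V0) t \<and> (\<nexists>u. pve_step A B c \<epsilon> t u)
          \<longrightarrow> (\<exists>V. t = Done V))"

end

theory Submission imports Defs begin

text \<open>
  A pass of the inner loop that adds no vertex certifies that every facet inequality of the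
  current hull is valid for the whole projection, so at tolerance \<open>0\<close> the hull equals the
  projection when the algorithm stops. Every other pass adds an extreme point of the projection,
  and there are only finitely many of these.
\<close>

section \<open>Facets of full-dimensional polyhedra\<close>

text \<open>Ensures that the hull-building step can be executed. In a minimal representation by
  half-spaces each half-space cuts out one facet, and full dimension makes the affine hull disappear
  from the representation.\<close>

lemma facet_description_exists:
  fixes P :: "'a::euclidean_space set"
  assumes "polyhedron P" "affine hull P = UNIV"
  obtains L where "facet_description P L"
proof -
  obtain F where F: "finite F" "P = affine hull P \<inter> \<Inter>F"
      "\<forall>h\<in>F. \<exists>a b. a \<noteq> 0 \<and> h = {x. a \<bullet> x \<le> b}"
      "\<forall>F'. F' \<subset> F \<longrightarrow> P \<subset> affine hull P \<inter> \<Inter>F'"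
    using assms(1) polyhedron_Int_affine_minimal[of P] by metis
  then obtain a b where ab: "\<And>h. h \<in> F \<Longrightarrow> a h \<noteq> 0 \<and> h = {x. a h \<bullet> x \<le> b h}"
    by metis
  have P: "P = \<Inter>F" using F(2) assms(2) by simp
  have facet: "C facet_of P \<longleftrightarrow> (\<exists>h. h \<in> F \<and> C = P \<inter> {x. a h \<bullet> x = b h})" for C
    using facet_of_polyhedron_explicit[OF F(1,2) ab] F(4) by blast
  \<comment> \<open>The empty set has empty affine hull, so \<open>P\<close> is nonempty and has a
    point \<open>w\<close> at which all inequalities are strict.\<close>
  have "rel_interior P \<noteq> {}"
    using assms polyhedron_imp_convex rel_interior_eq_empty
    by (metis affine_hull_empty empty_not_UNIV)
  moreover have "rel_interior P = {x \<in> P. \<forall>h\<in>F. a h \<bullet> x < b h}"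
    using rel_interior_polyhedron_explicit[OF F(1,2) ab] F(4) by blast
  ultimately obtain w where w: "\<And>h. h \<in> F \<Longrightarrow> a h \<bullet> w < b h" by blast
  \<comment> \<open>If \<open>z\<close> violates only the inequality of \<open>h\<close>, the segment from the interior point \<open>w\<close>
      to \<open>z\<close> leaves \<open>P\<close> at a point that lies on the facet of \<open>h\<close> and on no other facet.\<close>
  have distinct: "h = h'"
    if h: "h \<in> F" "h' \<in> F" and eq: "P \<inter> {x. a h \<bullet> x = b h} = P \<inter> {x. a h' \<bullet> x = b h'}" for h h'
  proof (rule ccontr)
    assume "h \<noteq> h'"
    have "F - {h} \<subset> F" using h by blast
    then have "P \<subset> \<Inter>(F - {h})" using F(4) assms(2) by simp
    then obtain z where z: "z \<in> \<Inter>(F - {h})" "z \<notin> P" by blast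
    have mem: "x \<in> g \<longleftrightarrow> a g \<bullet> x \<le> b g" if "g \<in> F" for g x
      using ab[OF that] by (metis mem_Collect_eq)
    have zg: "a g \<bullet> z \<le> b g" if "g \<in> F" "g \<noteq> h" for g
      using z(1) mem[OF that(1)] that by blast
    have "z \<notin> h" using z P by blast
    then have zh: "a h \<bullet> z > b h" using mem[OF h(1)] by (simp add: not_le)
    define t where "t = (b h - a h \<bullet> w) / (a h \<bullet> z - a h \<bullet> w)"
    have t: "0 < t" "t < 1" using w[OF h(1)] zh by (auto simp: t_def field_simps)
    define x where "x = (1 - t) *\<^sub>R w + t *\<^sub>R z"
    have ax: "a g \<bullet> x = (1 - t) * (a g \<bullet> w) + t * (a g \<bullet> z)" for g
      by (simp add: x_def inner_add_right)
    have "a h \<bullet> x = a h \<bullet> w + t * (a h \<bullet> z - a h \<bullet> w)"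
      by (simp add: ax algebra_simps)
    also have "\<dots> = b h" using w[OF h(1)] zh by (simp add: t_def)
    finally have xh: "a h \<bullet> x = b h" .
    have xg: "a g \<bullet> x < b g" if "g \<in> F" "g \<noteq> h" for g
    proof -
      \<comment> \<open>Strictness comes from \<open>w\<close>, whose weight \<open>1 - t\<close> is
        positive; \<open>z\<close> contributes only a weak inequality.\<close>
      have "(1 - t) * (a g \<bullet> w) < (1 - t) * b g" using t w[OF that(1)] by simp
      moreover have "t * (a g \<bullet> z) \<le> t * b g" using t zg[OF that] by simp
      ultimately show ?thesis by (simp add: ax algebra_simps)
    qed
    have "x \<in> g" if "g \<in> F" for g
      using mem[OF that] xh xg[OF that] by (cases "g = h") auto
    then have "x \<in> P" using P by blast
    then show False using eq xh xg[OF h(2)] \<open>h \<noteq> h'\<close> by force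
  qed
  obtain hs where hs: "set hs = F" "distinct hs"
    using finite_distinct_list[OF F(1)] by blast
  define L where "L = map (\<lambda>h. (a h, b h)) hs"
  have faces: "map (\<lambda>(a, d). P \<inter> {x. a \<bullet> x = d}) L = map (\<lambda>h. P \<inter> {x. a h \<bullet> x = b h}) hs"
    by (simp add: L_def)
  have "P = (\<Inter>h\<in>F. {x. a h \<bullet> x \<le> b h})"
    using P ab by (metis (no_types, lifting) INF_cong image_ident)
  then have "P = {x. \<forall>(a, d) \<in> set L. a \<bullet> x \<le> d}"
    by (auto simp: L_def hs)
  moreover have "\<forall>(a, d) \<in> set L. a \<noteq> 0" using ab by (auto simp: L_def hs)
  moreover have "distinct (map (\<lambda>h. P \<inter> {x. a h \<bullet> x = b h}) hs)"
    using hs distinct by (auto simp: distinct_map inj_on_def)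
  moreover have "set (map (\<lambda>h. P \<inter> {x. a h \<bullet> x = b h}) hs) = {F. F facet_of P}"
    using facet hs by auto
  ultimately have "facet_description P L"
    unfolding facet_description_def faces by blast
  then show thesis by (rule that)
qed

section \<open>The projection and its identified vertices\<close>

lemma projection_eq_image: "projection A B c = fst ` feasible_set A B c"
  by (force simp: projection_def)

lemma polytope_projection:
  "polytope (feasible_set A B c) \<Longrightarrow> polytope (projection A B c)"
  unfolding projection_eq_image by (rule polytope_linear_image[OF linear_fst])

lemma finite_extreme_points_polytope:
  fixes S :: "'a::euclidean_space set"
  assumes "polytope S"
  shows "finite {x. x extreme_point_of S}"
proof -
  obtain V where "finite V" "S = convex hull V" using assms unfolding polytope_def by blast
  then show ?thesis
    by (metis (no_types, lifting) extreme_point_of_convex_hull finite_subset mem_Collect_eq subsetI)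
qed

text \<open>Each point of the projection lifts to a feasible pair, which competes in the linear
  program.\<close>

lemma identified_vertex_maximal:
  assumes "identified_vertex A B c \<alpha> x" "z \<in> projection A B c"
  shows "\<alpha> \<bullet> z \<le> \<alpha> \<bullet> x"
  using assms by (fastforce simp: identified_vertex_def is_arg_max_def projection_def not_less)

text \<open>The maximizers of the objective over the compact projection form a nonempty compact
  face. An extreme point of this face is also extreme in the projection.\<close>

lemma identified_vertex_exists:
  assumes "polytope (feasible_set A B c)" "projection A B c \<noteq> {}"
  obtains x where "identified_vertex A B c \<alpha> x"
proof -
  let ?S = "projection A B c"
  have S: "compact ?S" "convex ?S"
    using polytope_projection[OF assms(1)] polytope_imp_compact polytope_imp_convex by auto
  have "continuous_on ?S (\<lambda>x. \<alpha> \<bullet> x)" by (intro continuous_intros)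
  then obtain m where m: "m \<in> ?S" "\<And>x. x \<in> ?S \<Longrightarrow> \<alpha> \<bullet> x \<le> \<alpha> \<bullet> m"
    using continuous_attains_sup[OF S(1) assms(2)] by blast
  let ?F = "?S \<inter> {x. \<alpha> \<bullet> x = \<alpha> \<bullet> m}"
  have face: "?F face_of ?S"
    by (rule face_of_Int_supporting_hyperplane_le[OF S(2) m(2)])
  obtain x where x: "x extreme_point_of ?F"
    using extreme_point_exists_convex[of ?F] face_of_imp_compact[OF S(2,1) face]
      face_of_imp_convex[OF face] m(1) by blast
  then have xS: "x extreme_point_of ?S" "x \<in> ?S" "\<alpha> \<bullet> x = \<alpha> \<bullet> m"
    using extreme_point_of_face[OF face] by auto
  then obtain y where "(x, y) \<in> feasible_set A B c" by (auto simp: projection_def)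
  moreover have "\<alpha> \<bullet> x' \<le> \<alpha> \<bullet> x" if "(x', y') \<in> feasible_set A B c" for x' y'
    using m(2) that xS(3) by (auto simp: projection_def)
  ultimately have "is_arg_max (\<lambda>(x, y). \<alpha> \<bullet> x) (\<lambda>z. z \<in> feasible_set A B c) (x, y)"
    by (auto simp: is_arg_max_def not_less)
  then show thesis using that xS(1) unfolding identified_vertex_def by blast
qed

text \<open>
  The implication from \<open>H = {}\<close> is what makes the algorithm exact: as long as no vertex has been
  added in the current pass, the inequalities already processed are valid for the projection.
\<close>
fun pve_invariant ::
  "real^'nx^'m \<Rightarrow> real^'ny^'m \<Rightarrow> real^'m \<Rightarrow> real \<Rightarrow> (real^'nx) set \<Rightarrow> (real^'nx) pve_state \<Rightarrow> bool"
where
  "pve_invariant A B c \<epsilon> V0 (Outer V) \<longleftrightarrow>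
     V0 \<subseteq> V \<and> V \<subseteq> {x. x extreme_point_of projection A B c}"
| "pve_invariant A B c \<epsilon> V0 (Inner V H L) \<longleftrightarrow>
     V0 \<subseteq> V \<and> V \<subseteq> {x. x extreme_point_of projection A B c} \<and>
     finite H \<and> (\<forall>h\<in>H. h > 0) \<and>
     (H = {} \<longrightarrow> (\<forall>(a, d)\<in>set L. a \<noteq> 0 \<and> (\<forall>v\<in>V. a \<bullet> v \<le> d)) \<and>
        {x \<in> projection A B c. \<forall>(a, d)\<in>set L. a \<bullet> x \<le> d} \<subseteq> convex hull V)"
| "pve_invariant A B c \<epsilon> V0 (Done V) \<longleftrightarrow>
     V0 \<subseteq> V \<and> V \<subseteq> {x. x extreme_point_of projection A B c} \<and>
     (\<epsilon> \<le> 0 \<longrightarrow> projection A B c \<subseteq> convex hull V)"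

text \<open>The case that carries the argument is \<open>skip_vertex\<close>: dropping an inequality
  from the list must not enlarge the part of the projection it cuts out.\<close>

lemma pve_invariant_step:
  assumes "pve_step A B c \<epsilon> s t" "pve_invariant A B c \<epsilon> V0 s"
  shows "pve_invariant A B c \<epsilon> V0 t"
  using assms
proof (cases rule: pve_step.cases)
  case (build_hull V L)
  then have eq: "convex hull V = {x. \<forall>(a, d)\<in>set L. a \<bullet> x \<le> d}"
    and "\<forall>(a, d)\<in>set L. a \<noteq> 0" by (auto simp: facet_description_def)
  moreover have "a \<bullet> v \<le> d" if "(a, d) \<in> set L" "v \<in> V" for a d v
    using eq hull_inc[OF that(2), of convex] that(1) by auto
  ultimately show ?thesis using build_hull assms(2) by auto
next
  \<comment> \<open>The new \<open>H\<close> is nonempty, so the implication from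
    \<open>H = {}\<close> holds vacuously.\<close>
  case (add_vertex a x d V H L)
  then show ?thesis using assms(2) by (auto simp: identified_vertex_def)
next
  case (skip_vertex a x d V H L)
  have "a \<bullet> z \<le> d" if "H = {}" "z \<in> projection A B c" for z
  proof -
    have ad: "a \<noteq> 0" "\<forall>v\<in>V. a \<bullet> v \<le> d"
      using assms(2) skip_vertex that(1) by auto
    \<comment> \<open>Both reasons for skipping give this bound: a nonpositive ratio because
      \<open>norm a\<close> is positive, and \<open>x \<in> V\<close> by the invariant.\<close>
    have "a \<bullet> x \<le> d"
      using skip_vertex(4) ad
      by (auto simp: improvement_ratio_def zero_less_divide_iff)
    then show ?thesis
      using identified_vertex_maximal[OF skip_vertex(3) that(2)] by simp
  qed
  then show ?thesis using assms(2) skip_vertex by auto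
next
  case (continue H V)
  then show ?thesis using assms(2) by auto
next
  case (stop H V)
  \<comment> \<open>A nonempty \<open>H\<close> has a positive maximum and would not pass the
    stopping test. With \<open>H\<close> and the list both empty, the invariant puts the whole
    projection into the hull.\<close>
  have "H = {}" if "\<epsilon> \<le> 0"
  proof (rule ccontr)
    assume "H \<noteq> {}"
    then have "Max H \<in> H" "Max H \<le> 0"
      using assms(2) stop that by (auto simp: max_improvement_def)
    then show False using assms(2) stop by force
  qed
  then show ?thesis using assms(2) stop by auto
qed

lemma pve_invariant_reachable:
  assumes "(pve_step A B c \<epsilon>)\<^sup>*\<^sup>* (Outer V0) t"
    and "V0 \<subseteq> {x. x extreme_point_of projection A B c}"
  shows "pve_invariant A B c \<epsilon> V0 t"
  using assms by (induction rule: rtranclp_induct) (auto intro: pve_invariant_step)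

text \<open>
  The second component drops along \<open>Inner\<close> with \<open>H \<noteq> {}\<close>, \<open>Outer\<close>, \<open>Inner\<close> with \<open>H = {}\<close>,
  \<open>Done\<close>; going back up this chain requires adding an element of \<open>E\<close>.
\<close>
fun pve_rank :: "'a set \<Rightarrow> 'a pve_state \<Rightarrow> nat \<times> nat \<times> nat" where
  "pve_rank E (Outer V) = (card (E - V), 2, 0)"
| "pve_rank E (Inner V H L) = (card (E - V), if H = {} then 1 else 3, length L)"
| "pve_rank E (Done V) = (card (E - V), 0, 0)"

lemma pve_rank_decreases:
  assumes "pve_step A B c \<epsilon> s t" "\<epsilon> \<ge> 0"
    and E: "finite E" "{x. x extreme_point_of projection A B c} \<subseteq> E"
  shows "(pve_rank E t, pve_rank E s) \<in> less_than <*lex*> less_than <*lex*> less_than"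
  using assms(1)
proof (cases rule: pve_step.cases)
  case (add_vertex a x d V H L)
  then have "x \<in> E - V" using E(2) by (auto simp: identified_vertex_def)
  then have "card (E - insert x V) < card (E - V)"
    using E(1) by (intro psubset_card_mono) auto
  then show ?thesis using add_vertex by simp
next
  case (continue H V)
  \<comment> \<open>By the convention for the empty maximum, an empty \<open>H\<close> would stop
    the loop as \<open>\<epsilon> \<ge> 0\<close>.\<close>
  then have "H \<noteq> {}" using assms(2) by (auto simp: max_improvement_def)
  then show ?thesis using continue by simp
qed auto

text \<open>Facet descriptions and solutions of the linear program exist whenever they are
  requested, and the guards of competing steps are complementary.\<close>

lemma pve_progress:
  assumes "polytope (feasible_set A B c)" "projection A B c \<noteq> {}"
    and "affine hull V0 = UNIV" "pve_invariant A B c \<epsilon> V0 t" "\<nexists>V. t = Done V"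
  shows "\<exists>u. pve_step A B c \<epsilon> t u"
proof (cases t)
  case (Outer V)
  then have V: "V0 \<subseteq> V" "V \<subseteq> {x. x extreme_point_of projection A B c}"
    using assms(4) by auto
  have "finite V"
    using V(2) finite_extreme_points_polytope[OF polytope_projection[OF assms(1)]]
    by (rule finite_subset)
  then have "polyhedron (convex hull V)" by (rule polyhedron_convex_hull)
  \<comment> \<open>This is why the invariant records \<open>V0 \<subseteq> V\<close>: later hulls
    inherit full dimension from the initial one.\<close>
  moreover have "affine hull (convex hull V) = UNIV"
    using hull_mono[OF V(1), of affine] assms(3) by auto
  ultimately obtain L where "facet_description (convex hull V) L"
    by (rule facet_description_exists)
  then show ?thesis using Outer pve_step.build_hull by blast
next
  case (Inner V H L)
  show ?thesis
  proof (cases L)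
    case Nil
    then show ?thesis using Inner pve_step.continue pve_step.stop by blast
  next
    case (Cons p L')
    obtain a d where p: "p = (a, d)" by fastforce
    obtain x where x: "identified_vertex A B c a x"
      by (rule identified_vertex_exists[OF assms(1,2)])
    show ?thesis
      using Inner Cons p pve_step.add_vertex[OF x, of d V] pve_step.skip_vertex[OF x, of d V]
      by blast
  qed
next
  case (Done V)
  then show ?thesis using assms(5) by blast
qed

section \<open>Correctness of the output and termination\<close>

lemma pve_output_inner:
  assumes "polytope (feasible_set A B c)"
    and "V0 \<subseteq> {x. x extreme_point_of projection A B c}"
    and "pve_output A B c \<epsilon> V0 P"
  shows "P \<subseteq> projection A B c"
proof -
  obtain V where V: "(pve_step A B c \<epsilon>)\<^sup>*\<^sup>* (Outer V0) (Done V)" "P = convex hull V"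
    using assms(3) unfolding pve_output_def by blast
  have "V \<subseteq> projection A B c"
    using pve_invariant_reachable[OF V(1) assms(2)] by (auto simp: extreme_point_of_def)
  then show ?thesis
    using V(2) polytope_imp_convex[OF polytope_projection[OF assms(1)]] by (simp add: hull_minimal)
qed

lemma pve_output_outer:
  assumes "V0 \<subseteq> {x. x extreme_point_of projection A B c}" "pve_output A B c 0 V0 P"
  shows "projection A B c \<subseteq> P"
proof -
  obtain V where V: "(pve_step A B c 0)\<^sup>*\<^sup>* (Outer V0) (Done V)" "P = convex hull V"
    using assms(2) unfolding pve_output_def by blast
  then show ?thesis using pve_invariant_reachable[OF V(1) assms(1)] by simp
qed

text \<open>The well-founded rank excludes infinite executions, and progress excludes stuck states
  other than \<open>Done\<close>.\<close>

lemma pve_terminates: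
  assumes "polytope (feasible_set A B c)" "\<epsilon> \<ge> 0"
    and "V0 \<subseteq> {x. x extreme_point_of projection A B c}" "affine hull V0 = UNIV"
  shows "pve_terminates A B c \<epsilon> V0"
proof -
  let ?E = "{x. x extreme_point_of projection A B c}"
  let ?R = "less_than <*lex*> less_than <*lex*> less_than"
  have fin: "finite ?E"
    by (rule finite_extreme_points_polytope[OF polytope_projection[OF assms(1)]])
  have wf: "wf ?R" by (intro wf_lex_prod wf_less_than)
  have "\<nexists>s. s 0 = Outer V0 \<and> (\<forall>i::nat. pve_step A B c \<epsilon> (s i) (s (Suc i)))"
  proof
    assume "\<exists>s. s 0 = Outer V0 \<and> (\<forall>i::nat. pve_step A B c \<epsilon> (s i) (s (Suc i)))"
    then obtain s where "\<And>i::nat. pve_step A B c \<epsilon> (s i) (s (Suc i))" by blast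
    then have "(pve_rank ?E (s (Suc i)), pve_rank ?E (s i)) \<in> ?R" for i
      using pve_rank_decreases[OF _ assms(2) fin] by blast
    then show False
      using wf_no_infinite_down_chainE[OF wf, of "\<lambda>i. pve_rank ?E (s i)"] by metis
  qed
  \<comment> \<open>Nonemptiness of the projection, inherited from \<open>V0\<close>, makes the
    linear programs feasible.\<close>
  moreover have "V0 \<noteq> {}" using assms(4) by auto
  then have "projection A B c \<noteq> {}" using assms(3) by (auto simp: extreme_point_of_def)
  then have "\<exists>V. t = Done V"
    if "(pve_step A B c \<epsilon>)\<^sup>*\<^sup>* (Outer V0) t" "\<nexists>u. pve_step A B c \<epsilon> t u" for t
    using pve_progress[OF assms(1) _ assms(4)] pve_invariant_reachable[OF that(1) assms(3)] that(2)
    by blast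
  ultimately show ?thesis unfolding pve_terminates_def by blast
qed

theorem theorem1:
  fixes A :: "real^'nx^'m" and B :: "real^'ny^'m" and c :: "real^'m"
    and \<epsilon> :: real and V0 :: "(real^'nx) set"
  assumes "polytope (feasible_set A B c)"
    and "\<epsilon> \<ge> 0"
    and "finite V0"
    and "card V0 \<ge> CARD('nx) + 1"
    and "\<And>v. v \<in> V0 \<Longrightarrow> v extreme_point_of (projection A B c)"
    and "aff_dim (convex hull V0) = int CARD('nx)"
  shows "(\<epsilon> > 0 \<longrightarrow> (\<forall>P. pve_output A B c \<epsilon> V0 P \<longrightarrow> P \<subseteq> projection A B c))
    \<and> (\<epsilon> = 0 \<longrightarrow> pve_terminates A B c \<epsilon> V0
          \<and> (\<forall>P. pve_output A B c \<epsilon> V0 P \<longrightarrow> P = projection A B c))"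
proof -
  have V0: "V0 \<subseteq> {x. x extreme_point_of projection A B c}" using assms(5) by blast
  have "affine hull V0 = UNIV"
    using assms(6) aff_dim_eq_full[of "convex hull V0"] by simp
  then have "pve_terminates A B c \<epsilon> V0" by (rule pve_terminates[OF assms(1,2) V0])
  then show ?thesis
    using pve_output_inner[OF assms(1) V0] pve_output_outer[OF V0] by blast
qed

end
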